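(* Let $\mathcal{H}$ be a nonzero complex Hilbert space, let $S$ and $T$ be bilateral operator valued weighted shifts on $\mathcal{H}$ with quasi-invertible operator weights $\{S_n\}_{n\in\mathbb{Z}}$ and $\{T_n\}_{n\in\mathbb{Z}}$, respectively, and let $m\in\mathbb{Z}$. Then the following are equivalent: (i) there exists a unitary operator $U\in \boldsymbol{B}(\ell_2(\mathbb{Z},\mathcal{H}))$ of diagonal form such that $US=TU$ and $U_{0,m}\neq 0$; (ii) there exist $k\in\mathbb{Z}$ and a unitary operator $V\in\boldsymbol{B}(\mathcal{H})$ such that both of the following hold: (a) $\|S_{m+n+k-1}\cdots S_{m+k} x\| = \|T_{n+k-1}\cdots T_k V x\|$ for all $x\in\mathcal{H}$ and all $n\in\mathbb{N}_+$, (b) $\|S_{m-n+k}^*\cdots S_{m-1+k}^* x\| = \|T_{-n+k}^*\cdots T_{-1+k}^* V x\|$ for all $x\in\mathcal{H}$ and all $n\in\mathbb{N}_+$.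
   Context: $\mathbb{N}_+$ is the set of positive integers. $\boldsymbol{B}(\mathcal{K})$ is the algebra of bounded linear operators on a Hilbert space $\mathcal{K}$. An operator $A\in\boldsymbol{B}(\mathcal{H})$ is quasi-invertible if it is injective and has dense range. $\ell_2(\mathbb{Z},\mathcal{H})=\bigoplus_{n\in\mathbb{Z}}\mathcal{H}$ is the Hilbert space of two-sided sequences $x=(x_n)_{n\in\mathbb{Z}}$ in $\mathcal{H}$ with $\sum_{n}\|x_n\|^2<\infty$ and inner product $\langle x,y\rangle=\sum_n\langle x_n,y_n\rangle$. Every $U\in\boldsymbol{B}(\ell_2(\mathbb{Z},\mathcal{H}))$ is identified with its operator matrix $[U_{i,j}]_{i,j\in\mathbb{Z}}$, $U_{i,j}\in\boldsymbol{B}(\mathcal{H})$, where $(Ux)_i=\sum_j U_{i,j}x_j$. Bilateral operator valued weighted shift: given a two-sided sequence $\{S_n\}_{n\in\mathbb{Z}}\subseteq\boldsymbol{B}(\mathcal{H})$ of nonzero operators with $\{\|S_n\|\}_{n\in\mathbb{Z}}$ bounded, it is the operator $S\in\boldsymbol{B}(\ell_2(\mathbb{Z},\mathcal{H}))$ defined by $(Sx)_n=S_n x_{n-1}$, $n\in\mathbb{Z}$; the $S_n$ are its weights. Diagonal operator: an operator $D\in\boldsymbol{B}(\ell_2(\mathbb{Z},\mathcal{H}))$ with $(Dx)_n=D_nx_n$ for some $\{D_n\}_{n\in\mathbb{Z}}\subseteq\boldsymbol{B}(\mathcal{H})$ with $\{\|D_n\|\}_{n\in\mathbb{Z}}$ bounded.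 Let $F$ be the unitary bilateral operator valued weighted shift all of whose weights are the identity on $\mathcal{H}$. An operator is of diagonal form if it equals $F^kD$ for some $k\in\mathbb{Z}$ and some diagonal operator $D$. *)

theory Defs
  imports "HOL-Analysis.Analysis"
begin

section \<open>Complex Hilbert spaces\<close>

class complex_vector = real_vector +
  fixes scaleC :: "complex \<Rightarrow> 'a \<Rightarrow> 'a" (infixr \<open>*\<^sub>C\<close> 75)
  assumes scaleC_add_right: "a *\<^sub>C (x + y) = a *\<^sub>C x + a *\<^sub>C y"
    and scaleC_add_left: "(a + b) *\<^sub>C x = a *\<^sub>C x + b *\<^sub>C x"
    and scaleC_scaleC: "a *\<^sub>C (b *\<^sub>C x) = (a * b) *\<^sub>C x"
    and scaleC_of_real: "complex_of_real r *\<^sub>C x = r *\<^sub>R x"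
begin

lemma scaleC_one [simp]: "1 *\<^sub>C x = x"
  using scaleC_of_real[of 1 x] scaleR_one[of x] by simp

end

text \<open>The complex inner product is linear in its first argument.  The real inner product of the
  library is its real part, so that the norm, the metric and the topology are those given by the
  complex inner product.\<close>

class complex_inner = complex_vector + real_inner +
  fixes cinner :: "'a \<Rightarrow> 'a \<Rightarrow> complex"
  assumes cinner_commute: "cinner x y = cnj (cinner y x)"
    and cinner_add_left: "cinner (x + y) z = cinner x z + cinner y z"
    and cinner_scaleC_left: "cinner (a *\<^sub>C x) y = a * cinner x y"
    and inner_eq_Re_cinner: "inner x y = Re (cinner x y)"
begin

lemma cinner_add_right: "cinner x (y + z) = cinner x y + cinner x z"
  by (metis cinner_commute cinner_add_left complex_cnj_add)

lemma cinner_scaleC_right: "cinner x (a *\<^sub>C y) = cnj a * cinner x y"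
  by (metis cinner_commute cinner_scaleC_left complex_cnj_mult)

lemma cinner_same: "cinner x x = complex_of_real ((norm x)\<^sup>2)"
proof -
  have "Im (cinner x x) = 0"
    using arg_cong[OF cinner_commute[of x x], of Im] by simp
  then show ?thesis
    by (simp add: complex_eq_iff power2_norm_eq_inner inner_eq_Re_cinner)
qed

lemma norm_scaleC: "norm (a *\<^sub>C x) = cmod a * norm x"
proof -
  have "complex_of_real ((norm (a *\<^sub>C x))\<^sup>2) = a * cnj a * cinner x x"
    by (metis cinner_same cinner_scaleC_left cinner_scaleC_right mult.assoc mult.left_commute)
  also have "\<dots> = complex_of_real ((cmod a * norm x)\<^sup>2)"
    using complex_norm_square[of a] by (simp add: cinner_same power_mult_distrib)
  finally have "(norm (a *\<^sub>C x))\<^sup>2 = (cmod a * norm x)\<^sup>2"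
    using of_real_eq_iff by blast
  then show ?thesis
    by (simp add: norm_eq_sqrt_inner)
qed

lemma cmod_cinner_le: "cmod (cinner x y) \<le> norm x * norm y"
proof -
  define c where "c = cnj (sgn (cinner x y))"
  have c: "c * cinner x y = complex_of_real (cmod (cinner x y))"
    by (cases "cinner x y = 0")
      (auto simp: c_def sgn_eq mult.commute[of "cnj _"] complex_norm_square[symmetric] power2_eq_square)
  have "cmod (cinner x y) = inner (c *\<^sub>C x) y"
    by (simp add: inner_eq_Re_cinner cinner_scaleC_left c)
  also have "\<dots> \<le> norm (c *\<^sub>C x) * norm y"
    by (rule norm_cauchy_schwarz)
  also have "\<dots> \<le> norm x * norm y"
  proof (intro mult_right_mono)
    have "0 \<le> norm x" by (simp add: norm_eq_sqrt_inner)
    then show "norm (c *\<^sub>C x) \<le> norm x"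
      unfolding norm_scaleC by (intro mult_left_le_one_le) (auto simp: c_def norm_sgn)
    show "0 \<le> norm y" by (simp add: norm_eq_sqrt_inner)
  qed
  finally show ?thesis .
qed

lemma cinner_eqI:
  assumes "\<And>x. cinner x y = cinner x z"
  shows "y = z"
proof -
  have "inner (y - z) (y - z) = 0"
    unfolding inner_diff_right using assms[of "y - z"] by (simp add: inner_eq_Re_cinner)
  then show ?thesis by simp
qed

end

class complex_hilbert_space = complex_inner + complete_space

instantiation complex :: complex_hilbert_space
begin

definition scaleC_complex :: "complex \<Rightarrow> complex \<Rightarrow> complex"
  where "scaleC_complex a x = a * x"

definition cinner_complex :: "complex \<Rightarrow> complex \<Rightarrow> complex"
  where "cinner_complex x y = x * cnj y"

instance
  by standard
    (auto simp: scaleC_complex_def cinner_complex_def algebra_simps scaleR_conv_of_real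
      inner_complex_def)

end

section \<open>Operators\<close>

definition bounded_clinear :: "('a::complex_inner \<Rightarrow> 'b::complex_inner) \<Rightarrow> bool"
  where "bounded_clinear A \<longleftrightarrow> bounded_linear A \<and> (\<forall>c x. A (c *\<^sub>C x) = c *\<^sub>C A x)"

definition cadjoint :: "('a::complex_inner \<Rightarrow> 'b::complex_inner) \<Rightarrow> 'b \<Rightarrow> 'a"
  where "cadjoint A = (THE B. \<forall>x y. cinner (A x) y = cinner x (B y))"

definition unitary :: "('a::complex_inner \<Rightarrow> 'a) \<Rightarrow> bool"
  where "unitary A \<longleftrightarrow> bounded_clinear A \<and> cadjoint A \<circ> A = id \<and> A \<circ> cadjoint A = id"

definition quasi_invertible :: "('a::complex_inner \<Rightarrow> 'a) \<Rightarrow> bool"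
  where "quasi_invertible A \<longleftrightarrow> bounded_clinear A \<and> inj A \<and> closure (range A) = UNIV"

lemma riesz_representation_real:
  fixes f :: "'a::{real_inner, complete_space} \<Rightarrow> real"
  assumes "bounded_linear f"
  shows "\<exists>y. \<forall>x. f x = inner x y"
proof -
  interpret f: bounded_linear f by fact
  obtain M where M: "\<And>x. norm (f x) \<le> norm x * M"
    using f.bounded by blast
  define q where "q x = (norm x)\<^sup>2 - 2 * f x" for x
  define I where "I = Inf (range q)"
  have q_lower: "- M\<^sup>2 \<le> q x" for x
  proof -
    have "0 \<le> (norm x - M)\<^sup>2" by simp
    then show ?thesis
      using M[of x] by (simp add: q_def power2_diff real_norm_def abs_le_iff mult.commute)
  qed
  then have bdd: "bdd_below (range q)"
    by (intro bdd_belowI[of _ "- M\<^sup>2"]) auto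
  have I_le: "I \<le> q x" for x
    unfolding I_def using bdd by (simp add: cInf_lower)
  have par: "(norm (x - z))\<^sup>2 \<le> 2 * (q x - I) + 2 * (q z - I)" for x z
  proof -
    have "q ((1/2) *\<^sub>R (x + z)) = (q x + q z) / 2 - (norm (x - z))\<^sup>2 / 4"
      by (simp add: q_def power2_norm_eq_inner f.scaleR f.add inner_add inner_diff
          inner_commute[of z x] field_simps)
    then show ?thesis
      using I_le[of "(1/2) *\<^sub>R (x + z)"] by argo
  qed
  have "\<exists>x. q x < I + 1 / real (Suc n)" for n
  proof -
    have "Inf (range q) < I + 1 / real (Suc n)"
      by (simp add: I_def)
    then show ?thesis
      using cInf_lessD[of "range q"] by blast
  qed
  then obtain X where X: "\<And>n. q (X n) < I + 1 / real (Suc n)"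
    by metis
  have "Cauchy X"
  proof (rule metric_CauchyI)
    fix e :: real assume "e > 0"
    obtain N where N: "4 / e\<^sup>2 < real N"
      using reals_Archimedean2 by blast
    have small: "q (X n) - I < e\<^sup>2 / 4" if "n \<ge> N" for n
    proof -
      have "4 / e\<^sup>2 < real (Suc n)" using N that by linarith
      then have "1 / real (Suc n) < e\<^sup>2 / 4"
        using \<open>e > 0\<close> by (simp add: field_simps)
      then show ?thesis using X[of n] by linarith
    qed
    have "dist (X m) (X n) < e" if "m \<ge> N" "n \<ge> N" for m n
    proof -
      have "(norm (X m - X n))\<^sup>2 < e\<^sup>2"
        using par[of "X m" "X n"] small[OF that(1)] small[OF that(2)] by argo
      then show ?thesis
        using \<open>e > 0\<close> by (simp add: dist_norm power_less_imp_less_base)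
    qed
    then show "\<exists>N. \<forall>m\<ge>N. \<forall>n\<ge>N. dist (X m) (X n) < e" by blast
  qed
  then obtain y where y: "X \<longlonglongrightarrow> y"
    using Cauchy_convergent convergent_def by blast
  have "(\<lambda>n. q (X n)) \<longlonglongrightarrow> q y"
    unfolding q_def by (intro tendsto_intros y f.tendsto)
  moreover have "(\<lambda>n. I + 1 / real (Suc n)) \<longlonglongrightarrow> I + 0"
    by (intro tendsto_intros LIMSEQ_inverse_real_of_nat[unfolded inverse_eq_divide])
  ultimately have "q y \<le> I + 0"
    by (rule LIMSEQ_le) (use X less_imp_le in blast)
  then have qy: "q y \<le> q x" for x
    using I_le[of x] by simp
  have "f v = inner v y" for v
  proof (rule ccontr)
    assume ne: "f v \<noteq> inner v y"
    define d where "d = f v - inner v y"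
    define s where "s = (norm v)\<^sup>2 + 1"
    have "s > 0" by (simp add: s_def add_nonneg_pos)
    have "q (y + t *\<^sub>R v) = q y + t\<^sup>2 * (norm v)\<^sup>2 - 2 * t * d" for t
      unfolding q_def d_def
      by (simp add: power2_norm_eq_inner f.scaleR f.add inner_add inner_commute[of y v]
          power2_eq_square[of t] algebra_simps)
    then have "2 * (d / s) * d \<le> (d / s)\<^sup>2 * (norm v)\<^sup>2"
      using qy[of "y + (d / s) *\<^sub>R v"] by simp
    also have "\<dots> \<le> (d / s)\<^sup>2 * s"
      by (intro mult_left_mono) (auto simp: s_def)
    also have "\<dots> = (d / s) * d"
      using \<open>s > 0\<close> by (simp add: power2_eq_square)
    finally have "d * d / s \<le> 0" by simp
    moreover have "d * d / s > 0"
      using ne \<open>s > 0\<close> by (simp add: d_def flip: power2_eq_square)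
    ultimately show False by simp
  qed
  then show ?thesis by blast
qed

lemma cadjoint_eqI:
  assumes "\<And>x y. cinner (A x) y = cinner x (B y)"
  shows "cadjoint A = B"
  unfolding cadjoint_def
proof (rule the_equality)
  fix C assume C: "\<forall>x y. cinner (A x) y = cinner x (C y)"
  show "C = B"
  proof
    fix y
    show "C y = B y"
      by (rule cinner_eqI) (metis C assms)
  qed
qed (use assms in blast)

lemma cinner_cadjoint:
  fixes A :: "'a::complex_hilbert_space \<Rightarrow> 'b::complex_inner"
  assumes A: "bounded_clinear A"
  shows "cinner (A x) y = cinner x (cadjoint A y)"
proof -
  have lin: "bounded_linear A" and cl: "\<And>c x. A (c *\<^sub>C x) = c *\<^sub>C A x"
    using A by (auto simp: bounded_clinear_def)
  have "\<exists>z. \<forall>x. inner (A x) y = inner x z" for y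
    using riesz_representation_real[OF bounded_linear_compose[OF bounded_linear_inner_left lin]] .
  then obtain B where B: "\<And>x y. inner (A x) y = inner x (B y)"
    by metis
  have "cinner (A x) y = cinner x (B y)" for x y
  proof (rule complex_eqI)
    show "Re (cinner (A x) y) = Re (cinner x (B y))"
      using B[of x y] by (simp add: inner_eq_Re_cinner)
    show "Im (cinner (A x) y) = Im (cinner x (B y))"
      using B[of "\<i> *\<^sub>C x" y] by (simp add: inner_eq_Re_cinner cl cinner_scaleC_left)
  qed
  then show ?thesis
    using cadjoint_eqI[of A B] by simp
qed

section \<open>Two-sided square-summable sequences\<close>

typedef (overloaded) 'a ell2Z = "{x :: int \<Rightarrow> 'a::complex_inner. (\<lambda>n. (norm (x n))\<^sup>2) summable_on UNIV}"
  morphisms coord Abs_ell2Z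
  by (intro exI[of _ "\<lambda>_. 0"]) simp

setup_lifting type_definition_ell2Z

lemma summable_coord: "(\<lambda>n. (norm (coord x n))\<^sup>2) summable_on UNIV"
  using coord by blast

lemma ell2Z_eqI: "(\<And>n. coord x n = coord y n) \<Longrightarrow> x = y"
  using coord_inject by blast

lemma square_norm_add_le:
  fixes a b :: "'a::real_inner"
  shows "(norm (a + b))\<^sup>2 \<le> 2 * (norm a)\<^sup>2 + 2 * (norm b)\<^sup>2"
proof -
  have "(norm (a + b))\<^sup>2 + (norm (a - b))\<^sup>2 = 2 * (norm a)\<^sup>2 + 2 * (norm b)\<^sup>2"
    by (simp add: power2_norm_eq_inner inner_add inner_diff)
  then show ?thesis
    using zero_le_power2[of "norm (a - b)"] by linarith
qed

lemma summable_cinner: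
  fixes x y :: "int \<Rightarrow> 'a::complex_inner"
  assumes "(\<lambda>n. (norm (x n))\<^sup>2) summable_on UNIV" "(\<lambda>n. (norm (y n))\<^sup>2) summable_on UNIV"
  shows "(\<lambda>n. cinner (x n) (y n)) summable_on UNIV"
proof (rule summable_on_iff_abs_summable_on_complex[THEN iffD2], rule Infinite_Sum.abs_summable_on_comparison_test')
  show "(\<lambda>n. (norm (x n))\<^sup>2 + (norm (y n))\<^sup>2) summable_on UNIV"
    by (intro summable_on_add assms)
  fix n
  have "norm (x n) * norm (y n) \<le> (norm (x n))\<^sup>2 + (norm (y n))\<^sup>2"
    using sum_squares_bound[of "norm (x n)" "norm (y n)"]
      mult_nonneg_nonneg[OF norm_ge_zero[of "x n"] norm_ge_zero[of "y n"]]
    by linarith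
  then show "norm (cinner (x n) (y n)) \<le> (norm (x n))\<^sup>2 + (norm (y n))\<^sup>2"
    using cmod_cinner_le[of "x n" "y n"] by linarith
qed

instantiation ell2Z :: (complex_inner) complex_inner
begin

lift_definition zero_ell2Z :: "'a ell2Z" is "\<lambda>_. 0" by simp

lift_definition plus_ell2Z :: "'a ell2Z \<Rightarrow> 'a ell2Z \<Rightarrow> 'a ell2Z" is "\<lambda>x y n. x n + y n"
proof -
  fix x y :: "int \<Rightarrow> 'a"
  assume "(\<lambda>n. (norm (x n))\<^sup>2) summable_on UNIV" "(\<lambda>n. (norm (y n))\<^sup>2) summable_on UNIV"
  then have "(\<lambda>n. 2 * (norm (x n))\<^sup>2 + 2 * (norm (y n))\<^sup>2) summable_on UNIV"
    by (intro summable_on_add summable_on_cmult_right)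
  then show "(\<lambda>n. (norm (x n + y n))\<^sup>2) summable_on UNIV"
    by (rule summable_on_comparison_test) (auto intro: square_norm_add_le)
qed

lift_definition uminus_ell2Z :: "'a ell2Z \<Rightarrow> 'a ell2Z" is "\<lambda>x n. - x n" by simp

definition minus_ell2Z :: "'a ell2Z \<Rightarrow> 'a ell2Z \<Rightarrow> 'a ell2Z"
  where "minus_ell2Z x y = x + - y"

lift_definition scaleR_ell2Z :: "real \<Rightarrow> 'a ell2Z \<Rightarrow> 'a ell2Z" is "\<lambda>r x n. r *\<^sub>R x n"
  by (auto simp: power_mult_distrib intro!: summable_on_cmult_right)

lift_definition scaleC_ell2Z :: "complex \<Rightarrow> 'a ell2Z \<Rightarrow> 'a ell2Z" is "\<lambda>c x n. c *\<^sub>C x n"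
  by (auto simp: norm_scaleC power_mult_distrib intro!: summable_on_cmult_right)

definition cinner_ell2Z :: "'a ell2Z \<Rightarrow> 'a ell2Z \<Rightarrow> complex"
  where "cinner_ell2Z x y = (\<Sum>\<^sub>\<infinity>n. cinner (coord x n) (coord y n))"

definition inner_ell2Z :: "'a ell2Z \<Rightarrow> 'a ell2Z \<Rightarrow> real"
  where "inner_ell2Z x y = Re (cinner x y)"

definition norm_ell2Z :: "'a ell2Z \<Rightarrow> real"
  where "norm_ell2Z x = sqrt (inner x x)"

definition sgn_ell2Z :: "'a ell2Z \<Rightarrow> 'a ell2Z"
  where "sgn_ell2Z x = inverse (norm x) *\<^sub>R x"

definition dist_ell2Z :: "'a ell2Z \<Rightarrow> 'a ell2Z \<Rightarrow> real"
  where "dist_ell2Z x y = norm (x - y)"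

definition uniformity_ell2Z :: "('a ell2Z \<times> 'a ell2Z) filter"
  where "uniformity_ell2Z = (INF e\<in>{0<..}. principal {(x, y). dist x y < e})"

definition open_ell2Z :: "'a ell2Z set \<Rightarrow> bool"
  where "open_ell2Z U \<longleftrightarrow> (\<forall>x\<in>U. eventually (\<lambda>(x', y). x' = x \<longrightarrow> y \<in> U) uniformity)"

instance
proof
  fix x y z :: "'a ell2Z" and a b :: complex and r s :: real
  show "x + y + z = x + (y + z)" by transfer (simp add: add.assoc)
  show "x + y = y + x" by transfer (simp add: add.commute)
  show "0 + x = x" by transfer simp
  show "- x + x = 0" by transfer simp
  show "x - y = x + - y" by (rule minus_ell2Z_def)
  show "r *\<^sub>R (x + y) = r *\<^sub>R x + r *\<^sub>R y" by transfer (simp add: scaleR_add_right)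
  show "(r + s) *\<^sub>R x = r *\<^sub>R x + s *\<^sub>R x" by transfer (simp add: scaleR_add_left)
  show "r *\<^sub>R s *\<^sub>R x = (r * s) *\<^sub>R x" by transfer simp
  show "1 *\<^sub>R x = x" by transfer simp
  show "a *\<^sub>C (x + y) = a *\<^sub>C x + a *\<^sub>C y" by transfer (simp add: scaleC_add_right)
  show "(a + b) *\<^sub>C x = a *\<^sub>C x + b *\<^sub>C x" by transfer (simp add: scaleC_add_left)
  show "a *\<^sub>C (b *\<^sub>C x) = (a * b) *\<^sub>C x" by transfer (simp add: scaleC_scaleC)
  show "complex_of_real r *\<^sub>C x = r *\<^sub>R x" by transfer (simp add: scaleC_of_real)
  show "sgn x = inverse (norm x) *\<^sub>R x" by (rule sgn_ell2Z_def)
  show "dist x y = norm (x - y)" by (rule dist_ell2Z_def)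
  show "(uniformity :: ('a ell2Z \<times> 'a ell2Z) filter)
      = (INF e\<in>{0<..}. principal {(x, y). dist x y < e})"
    by (rule uniformity_ell2Z_def)
  show "open U \<longleftrightarrow> (\<forall>x\<in>U. eventually (\<lambda>(x', y). x' = x \<longrightarrow> y \<in> U) uniformity)"
    for U :: "'a ell2Z set"
    by (rule open_ell2Z_def)
  show "norm x = sqrt (inner x x)" by (rule norm_ell2Z_def)
  show re: "inner x y = Re (cinner x y)" for x y :: "'a ell2Z" by (rule inner_ell2Z_def)
  show commute: "cinner x y = cnj (cinner y x)" for x y :: "'a ell2Z"
    unfolding cinner_ell2Z_def
    by (subst infsum_cnj[symmetric]) (intro infsum_cong cinner_commute)
  show add: "cinner (x + y) z = cinner x z + cinner y z" for x y z :: "'a ell2Z"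
    unfolding cinner_ell2Z_def plus_ell2Z.rep_eq cinner_add_left
    by (intro infsum_add summable_cinner summable_coord)
  show scaleC: "cinner (a *\<^sub>C x) y = a * cinner x y" for a and x y :: "'a ell2Z"
    unfolding cinner_ell2Z_def scaleC_ell2Z.rep_eq cinner_scaleC_left
    by (rule infsum_cmult_right')
  have R: "r *\<^sub>R x = complex_of_real r *\<^sub>C x" for r and x :: "'a ell2Z"
    by transfer (simp add: scaleC_of_real)
  show "inner x y = inner y x" using commute[of x y] by (simp add: re)
  show "inner (x + y) z = inner x z + inner y z" unfolding re add by simp
  show "inner (r *\<^sub>R x) y = r * inner x y" unfolding re R scaleC by simp
  have sq: "inner x x = (\<Sum>\<^sub>\<infinity>n. (norm (coord x n))\<^sup>2)"
    unfolding re cinner_ell2Z_def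
    unfolding cinner_same
    by (subst infsumI[OF has_sum_of_real[OF has_sum_infsum[OF summable_coord]]]) simp
  show "0 \<le> inner x x" by (simp add: sq infsum_nonneg)
  show "inner x x = 0 \<longleftrightarrow> x = 0"
  proof
    assume 0: "inner x x = 0"
    have "(norm (coord x n))\<^sup>2 = 0" for n
      by (rule nonneg_infsum_le_0D[of _ UNIV]) (use summable_coord[of x] 0[unfolded sq] in simp_all)
    then show "x = 0"
      by (intro ell2Z_eqI) (simp add: zero_ell2Z.rep_eq)
  next
    assume "x = 0"
    then show "inner x x = 0"
      unfolding sq by (simp add: zero_ell2Z.rep_eq)
  qed
qed

end

lemma coord_zero [simp]: "coord 0 n = 0"
  by (simp add: zero_ell2Z.rep_eq)

lemma coord_add: "coord (x + y) n = coord x n + coord y n"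
  by (simp add: plus_ell2Z.rep_eq)

lemma coord_diff: "coord (x - y) n = coord x n - coord y n"
  unfolding minus_ell2Z_def plus_ell2Z.rep_eq uminus_ell2Z.rep_eq by simp

lemma coord_scaleR: "coord (r *\<^sub>R x) n = r *\<^sub>R coord x n"
  by (simp add: scaleR_ell2Z.rep_eq)

lemma coord_scaleC: "coord (c *\<^sub>C x) n = c *\<^sub>C coord x n"
  by (simp add: scaleC_ell2Z.rep_eq)

lemma norm_ell2Z_square: "(norm x)\<^sup>2 = (\<Sum>\<^sub>\<infinity>n. (norm (coord x n))\<^sup>2)"
proof -
  have "complex_of_real ((norm x)\<^sup>2) = cinner x x"
    by (rule cinner_same[symmetric])
  also have "\<dots> = complex_of_real (\<Sum>\<^sub>\<infinity>n. (norm (coord x n))\<^sup>2)"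
    unfolding cinner_ell2Z_def cinner_same
    by (rule infsumI[OF has_sum_of_real[OF has_sum_infsum[OF summable_coord]]])
  finally show ?thesis
    by (simp only: of_real_eq_iff)
qed

lemma sum_norm_coord_le: "finite F \<Longrightarrow> (\<Sum>n\<in>F. (norm (coord x n))\<^sup>2) \<le> (norm x)\<^sup>2"
  unfolding norm_ell2Z_square by (intro finite_sum_le_infsum summable_coord zero_le_power2) simp_all

lemma norm_coord_le: "norm (coord x n) \<le> norm x"
  using sum_norm_coord_le[of "{n}" x]
  by (simp add: power2_le_iff_abs_le)

lemma bounded_linear_coord: "bounded_linear (\<lambda>x. coord x n)"
  by (rule bounded_linear_intro[where K = 1]) (simp_all add: coord_add coord_scaleR norm_coord_le)

lemma norm_ell2Z_leI:
  assumes "\<And>F. finite F \<Longrightarrow> (\<Sum>n\<in>F. (norm (coord x n))\<^sup>2) \<le> c\<^sup>2" "c \<ge> 0"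
  shows "norm x \<le> c"
proof -
  have "(norm x)\<^sup>2 \<le> c\<^sup>2"
    unfolding norm_ell2Z_square
    by (rule infsum_le_finite_sums[OF summable_coord]) (use assms(1) in blast)
  then show ?thesis
    using assms(2) by (rule power2_le_imp_le)
qed

instance ell2Z :: (complex_hilbert_space) complex_hilbert_space
proof
  fix X :: "nat \<Rightarrow> 'a ell2Z"
  assume X: "Cauchy X"
  have "Cauchy (\<lambda>k. coord (X k) n)" for n
    using bounded_linear.Cauchy[OF bounded_linear_coord X] .
  then have "\<exists>l. (\<lambda>k. coord (X k) n) \<longlonglongrightarrow> l" for n
    using Cauchy_convergent convergent_def by blast
  then obtain L where L: "\<And>n. (\<lambda>k. coord (X k) n) \<longlonglongrightarrow> L n"
    by metis
  have bound: "\<exists>N. \<forall>m\<ge>N. \<forall>F. finite F \<longrightarrow> (\<Sum>n\<in>F. (norm (coord (X m) n - L n))\<^sup>2) \<le> e\<^sup>2"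
    if "e > 0" for e
  proof -
    obtain N where N: "\<And>m k. m \<ge> N \<Longrightarrow> k \<ge> N \<Longrightarrow> norm (X m - X k) < e"
      using X \<open>e > 0\<close> unfolding Cauchy_def dist_norm by blast
    have "(\<Sum>n\<in>F. (norm (coord (X m) n - L n))\<^sup>2) \<le> e\<^sup>2" if "m \<ge> N" "finite F" for m F
    proof (rule LIMSEQ_le_const2)
      show "(\<lambda>k. \<Sum>n\<in>F. (norm (coord (X m) n - coord (X k) n))\<^sup>2)
          \<longlonglongrightarrow> (\<Sum>n\<in>F. (norm (coord (X m) n - L n))\<^sup>2)"
        by (intro tendsto_intros L)
      have "(\<Sum>n\<in>F. (norm (coord (X m) n - coord (X k) n))\<^sup>2) \<le> e\<^sup>2" if "k \<ge> N" for k
      proof -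
        have "(\<Sum>n\<in>F. (norm (coord (X m) n - coord (X k) n))\<^sup>2) \<le> (norm (X m - X k))\<^sup>2"
          using sum_norm_coord_le[OF \<open>finite F\<close>, of "X m - X k"] by (simp add: coord_diff)
        also have "\<dots> \<le> e\<^sup>2"
          using N[OF \<open>m \<ge> N\<close> that] by (intro power_mono) auto
        finally show ?thesis .
      qed
      then show "\<exists>N. \<forall>k\<ge>N. (\<Sum>n\<in>F. (norm (coord (X m) n - coord (X k) n))\<^sup>2) \<le> e\<^sup>2"
        by blast
    qed
    then show ?thesis by blast
  qed
  obtain N where N: "\<And>F. finite F \<Longrightarrow> (\<Sum>n\<in>F. (norm (coord (X N) n - L n))\<^sup>2) \<le> 1\<^sup>2"
    using bound[OF zero_less_one] by blast
  have "(\<lambda>n. (norm (coord (X N) n - L n))\<^sup>2) summable_on UNIV"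
    using N by (intro nonneg_bounded_partial_sums_imp_summable_on[of _ _ "1\<^sup>2"]
        eventually_finite_subsets_at_top_weakI zero_le_power2)
  then have D: "coord (Abs_ell2Z (\<lambda>n. coord (X N) n - L n)) = (\<lambda>n. coord (X N) n - L n)"
    by (intro Abs_ell2Z_inverse) simp
  define l where "l = X N - Abs_ell2Z (\<lambda>n. coord (X N) n - L n)"
  have l: "coord l n = L n" for n
    by (simp add: l_def coord_diff D)
  have "X \<longlonglongrightarrow> l"
  proof (rule LIMSEQ_I)
    fix e :: real assume "e > 0"
    then obtain M where M: "\<And>m F. m \<ge> M \<Longrightarrow> finite F \<Longrightarrow>
        (\<Sum>n\<in>F. (norm (coord (X m) n - L n))\<^sup>2) \<le> (e / 2)\<^sup>2"
      using bound[OF half_gt_zero] by blast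
    have "norm (X m - l) < e" if "m \<ge> M" for m
    proof -
      have "norm (X m - l) \<le> e / 2"
        using M[OF that] \<open>e > 0\<close> by (intro norm_ell2Z_leI) (auto simp: coord_diff l)
      then show ?thesis using \<open>e > 0\<close> by simp
    qed
    then show "\<exists>M. \<forall>m\<ge>M. norm (X m - l) < e" by blast
  qed
  then show "convergent X"
    by (auto simp: convergent_def)
qed

section \<open>Operator matrices\<close>

lift_definition ell2Z_single :: "int \<Rightarrow> 'a::complex_inner \<Rightarrow> 'a ell2Z"
  is "\<lambda>j h n. if n = j then h else 0"
  by (rule finite_nonzero_values_imp_summable_on) (auto intro: finite_subset[of _ "{_}"])

text \<open>The entry \<open>U\<^sub>i\<^sub>j\<close> is obtained by compressing \<open>U\<close> to the \<open>j\<close>-th and \<open>i\<close>-th summands;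
  the lemma \<open>has_sum_matrix_entry\<close> below shows that these are the operators with
  \<open>(U x)\<^sub>i = \<Sum>\<^sub>j U\<^sub>i\<^sub>j x\<^sub>j\<close>.\<close>

definition matrix_entry :: "('a::complex_inner ell2Z \<Rightarrow> 'a ell2Z) \<Rightarrow> int \<Rightarrow> int \<Rightarrow> 'a \<Rightarrow> 'a"
  where "matrix_entry U i j h = coord (U (ell2Z_single j h)) i"

lemma has_sum_ell2Z_single:
  "((\<lambda>j. ell2Z_single j (coord x j)) has_sum x) UNIV"
proof -
  have coord_sum: "coord (\<Sum>j\<in>F. ell2Z_single j (coord x j)) n = (if n \<in> F then coord x n else 0)"
    if "finite F" for F n
    using that
    by (induction F rule: finite_induct) (auto simp: coord_add ell2Z_single.rep_eq)
  have norm_diff: "(norm ((\<Sum>j\<in>F. ell2Z_single j (coord x j)) - x))\<^sup>2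
      = (norm x)\<^sup>2 - (\<Sum>j\<in>F. (norm (coord x j))\<^sup>2)" if "finite F" for F
  proof -
    have "(norm ((\<Sum>j\<in>F. ell2Z_single j (coord x j)) - x))\<^sup>2
        = (\<Sum>\<^sub>\<infinity>n. if n \<in> F then 0 else (norm (coord x n))\<^sup>2)"
      unfolding norm_ell2Z_square coord_diff coord_sum[OF that]
      by (intro infsum_cong) auto
    also have "\<dots> = (\<Sum>\<^sub>\<infinity>n\<in>UNIV - F. (norm (coord x n))\<^sup>2)"
      by (rule infsum_cong_neutral) auto
    also have "\<dots> = (norm x)\<^sup>2 - (\<Sum>j\<in>F. (norm (coord x j))\<^sup>2)"
      unfolding norm_ell2Z_square using that
      by (subst infsum_Diff) (auto intro: summable_coord)
    finally show ?thesis .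
  qed
  have "((\<lambda>F. (norm x)\<^sup>2 - (\<Sum>j\<in>F. (norm (coord x j))\<^sup>2))
      \<longlongrightarrow> (norm x)\<^sup>2 - (norm x)\<^sup>2) (finite_subsets_at_top UNIV)"
    using has_sum_infsum[OF summable_coord[of x]]
    unfolding norm_ell2Z_square[of x, symmetric] has_sum_def
    by (intro tendsto_intros)
  then have "((\<lambda>F. (norm ((\<Sum>j\<in>F. ell2Z_single j (coord x j)) - x))\<^sup>2) \<longlongrightarrow> 0)
      (finite_subsets_at_top UNIV)"
    by (subst tendsto_cong[of _ "\<lambda>F. (norm x)\<^sup>2 - (\<Sum>j\<in>F. (norm (coord x j))\<^sup>2)"])
      (simp_all add: norm_diff eventually_finite_subsets_at_top_weakI)
  then have "((\<lambda>F. sqrt ((norm ((\<Sum>j\<in>F. ell2Z_single j (coord x j)) - x))\<^sup>2)) \<longlongrightarrow> sqrt 0)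
      (finite_subsets_at_top UNIV)"
    by (rule tendsto_real_sqrt)
  then show ?thesis
    unfolding has_sum_def by (simp add: tendsto_norm_zero_iff LIM_zero_iff)
qed

lemma has_sum_matrix_entry:
  assumes "bounded_clinear U"
  shows "((\<lambda>j. matrix_entry U i j (coord x j)) has_sum coord (U x) i) UNIV"
proof -
  have "bounded_linear (\<lambda>x. coord (U x) i)"
    using bounded_linear_compose[OF bounded_linear_coord] assms
    by (auto simp: bounded_clinear_def)
  from has_sum_bounded_linear[OF this has_sum_ell2Z_single[of x]] show ?thesis
    by (simp add: matrix_entry_def)
qed

section \<open>Weighted shifts and operators of diagonal form\<close>

definition is_weighted_shift ::
    "('a::complex_inner ell2Z \<Rightarrow> 'a ell2Z) \<Rightarrow> (int \<Rightarrow> 'a \<Rightarrow> 'a) \<Rightarrow> bool"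
  where "is_weighted_shift S W \<longleftrightarrow>
    (\<forall>n. bounded_clinear (W n) \<and> W n \<noteq> (\<lambda>_. 0)) \<and> bdd_above (range (\<lambda>n. onorm (W n))) \<and>
    bounded_clinear S \<and> (\<forall>x n. coord (S x) n = W n (coord x (n - 1)))"

definition is_diagonal :: "('a::complex_inner ell2Z \<Rightarrow> 'a ell2Z) \<Rightarrow> bool"
  where "is_diagonal D \<longleftrightarrow> bounded_clinear D \<and>
    (\<exists>W. (\<forall>n. bounded_clinear (W n)) \<and> bdd_above (range (\<lambda>n. onorm (W n))) \<and>
      (\<forall>x n. coord (D x) n = W n (coord x n)))"

lift_definition Fshift :: "'a::complex_inner ell2Z \<Rightarrow> 'a ell2Z" is "\<lambda>x n. x (n - 1)"
  by (subst summable_on_reindex_bij_betw[where g = "\<lambda>n. n - 1"]) (auto intro: bij_betw_byWitness[where f' = "\<lambda>n. n + 1"])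

lemma coord_Fshift: "coord (Fshift x) n = coord x (n - 1)"
  by (simp add: Fshift.rep_eq)

lemma bounded_clinear_ell2Z_I:
  assumes coord: "\<And>x n. coord (A x) n = W n (coord x (g n))"
    and g: "bij g"
    and W: "\<And>n. bounded_clinear (W n)"
    and bdd: "bdd_above (range (\<lambda>n. onorm (W n)))"
  shows "bounded_clinear A"
proof -
  have lin: "bounded_linear (W n)" and cl: "W n (c *\<^sub>C h) = c *\<^sub>C W n h" for n c h
    using W[of n] by (auto simp: bounded_clinear_def)
  obtain B where B: "\<And>n. onorm (W n) \<le> B"
    using bdd by (auto simp: bdd_above_def)
  have "0 \<le> B"
    using onorm_pos_le[OF lin] B order_trans by blast
  have W_le: "norm (W n h) \<le> B * norm h" for n h
    using onorm[OF lin, of n h] mult_right_mono[OF B norm_ge_zero, of n h] by linarith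
  have "norm (A x) \<le> norm x * B" for x
  proof (rule norm_ell2Z_leI)
    fix F :: "int set" assume "finite F"
    have "(\<Sum>n\<in>F. (norm (coord (A x) n))\<^sup>2) \<le> (\<Sum>n\<in>F. B\<^sup>2 * (norm (coord x (g n)))\<^sup>2)"
      unfolding coord power_mult_distrib[symmetric]
      by (intro sum_mono power_mono W_le) auto
    also have "\<dots> = B\<^sup>2 * (\<Sum>n\<in>g ` F. (norm (coord x n))\<^sup>2)"
      using bij_is_inj[OF g]
      by (simp add: sum_distrib_left sum.reindex inj_on_subset[of _ UNIV])
    also have "\<dots> \<le> B\<^sup>2 * (norm x)\<^sup>2"
      using \<open>finite F\<close> by (intro mult_left_mono sum_norm_coord_le) auto
    finally show "(\<Sum>n\<in>F. (norm (coord (A x) n))\<^sup>2) \<le> (norm x * B)\<^sup>2"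
      by (simp add: power_mult_distrib mult.commute)
  qed (simp add: \<open>0 \<le> B\<close>)
  moreover have "A (x + y) = A x + A y" for x y
    by (rule ell2Z_eqI) (simp add: coord coord_add linear_add[OF bounded_linear.linear[OF lin]])
  moreover have "A (r *\<^sub>R x) = r *\<^sub>R A x" for r x
    by (rule ell2Z_eqI)
      (simp add: coord coord_scaleR linear_scale[OF bounded_linear.linear[OF lin]])
  moreover have "A (c *\<^sub>C x) = c *\<^sub>C A x" for c x
    by (rule ell2Z_eqI) (simp add: coord coord_scaleC cl)
  ultimately show ?thesis
    unfolding bounded_clinear_def by (blast intro: bounded_linear_intro)
qed

lemma is_weighted_shift_Fshift:
  assumes "\<exists>h::'h::complex_inner. h \<noteq> 0"
  shows "is_weighted_shift (Fshift :: 'h ell2Z \<Rightarrow> 'h ell2Z) (\<lambda>_. id)"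
proof -
  have id: "bounded_clinear (id :: 'h \<Rightarrow> 'h)"
    by (simp add: bounded_clinear_def bounded_linear_ident id_def)
  have "bij (\<lambda>n::int. n - 1)"
    by (rule bij_betw_byWitness[where f' = "\<lambda>n. n + 1"]) auto
  then have "bounded_clinear (Fshift :: 'h ell2Z \<Rightarrow> 'h ell2Z)"
    using bounded_clinear_ell2Z_I[of Fshift "\<lambda>_. id" "\<lambda>n. n - 1"] id
    by (simp add: coord_Fshift)
  then show ?thesis
    using assms id by (auto simp: is_weighted_shift_def coord_Fshift fun_eq_iff)
qed

lemma bij_Fshift: "bij (Fshift :: 'h::complex_inner ell2Z \<Rightarrow> 'h ell2Z)"
proof -
  have "\<exists>y. Fshift y = x" for x :: "'h ell2Z"
  proof -
    have "(\<lambda>n. (norm (coord x (n + 1)))\<^sup>2) summable_on UNIV"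
      by (subst summable_on_reindex_bij_betw[where g = "\<lambda>n. n + 1"])
        (auto intro: bij_betw_byWitness[where f' = "\<lambda>n. n - 1"] summable_coord)
    then have "coord (Abs_ell2Z (\<lambda>n. coord x (n + 1))) = (\<lambda>n. coord x (n + 1))"
      by (intro Abs_ell2Z_inverse) simp
    then show ?thesis
      by (intro exI[of _ "Abs_ell2Z (\<lambda>n. coord x (n + 1))"] ell2Z_eqI) (simp add: coord_Fshift)
  qed
  moreover have "inj (Fshift :: 'h ell2Z \<Rightarrow> 'h ell2Z)"
  proof (intro injI ell2Z_eqI)
    fix x y :: "'h ell2Z" and n
    assume "Fshift x = Fshift y"
    then have "coord (Fshift x) (n + 1) = coord (Fshift y) (n + 1)" by simp
    then show "coord x n = coord y n" by (simp add: coord_Fshift)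
  qed
  ultimately show ?thesis
    unfolding bij_def surj_def by metis
qed

definition int_funpow :: "('a \<Rightarrow> 'a) \<Rightarrow> int \<Rightarrow> 'a \<Rightarrow> 'a"
  where "int_funpow f k = (if k \<ge> 0 then f ^^ nat k else inv f ^^ nat (- k))"

lemma coord_int_funpow_Fshift:
  fixes x :: "'a::complex_inner ell2Z"
  shows "coord (int_funpow Fshift k x) n = coord x (n - k)"
proof -
  have inv: "coord (inv Fshift x) n = coord x (n + 1)" for x :: "'a ell2Z" and n
    using coord_Fshift[of "inv Fshift x" "n + 1"]
    unfolding surj_f_inv_f[OF bij_is_surj[OF bij_Fshift]] by simp
  have "coord ((Fshift ^^ j) x) n = coord x (n - int j)" for j n
    by (induction j arbitrary: n) (simp_all add: coord_Fshift algebra_simps)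
  moreover have "coord ((inv Fshift ^^ j) x) n = coord x (n + int j)" for j n
    by (induction j arbitrary: n) (simp_all add: inv algebra_simps)
  ultimately show ?thesis
    by (simp add: int_funpow_def)
qed

definition of_diagonal_form :: "('a::complex_inner ell2Z \<Rightarrow> 'a ell2Z) \<Rightarrow> bool"
  where "of_diagonal_form A \<longleftrightarrow> (\<exists>k D. is_diagonal D \<and> A = int_funpow Fshift k \<circ> D)"

end

theory Submission
  imports Defs
begin

text \<open>An operator of diagonal form with nonzero entry in position \<open>(0, m)\<close> has the form
  \<open>(U x)\<^sub>n = V\<^sub>n x\<^sub>n\<^sub>+\<^sub>m\<close>, and it is a unitary intertwiner iff all \<open>V\<^sub>n\<close> are unitary and
  \<open>V\<^sub>n S\<^sub>n\<^sub>+\<^sub>m = T\<^sub>n V\<^sub>n\<^sub>-\<^sub>1\<close>, equivalently \<open>T\<^sub>n\<^sup>* V\<^sub>n = V\<^sub>n\<^sub>-\<^sub>1 S\<^sub>n\<^sub>+\<^sub>m\<^sup>*\<close>.  Iterating the first relation forwards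
  and the second one backwards from \<open>V = V\<^sub>k\<^sub>-\<^sub>1\<close> gives the norm equalities.  Conversely, the norm
  equalities say that the products of the weights define isometries between their dense ranges;
  the extensions of these to the whole space are the remaining \<open>V\<^sub>n\<close>.\<close>

section \<open>Unitary operators\<close>

lemma bounded_clinearD:
  assumes "bounded_clinear A"
  shows "bounded_linear A" "A (x + y) = A x + A y" "A (x - y) = A x - A y"
    "A (c *\<^sub>C x) = c *\<^sub>C A x" "continuous_on X A"
    "A (r *\<^sub>R x) = r *\<^sub>R A x"
  using assms
  by (auto simp: bounded_clinear_def linear_continuous_on bounded_linear.linear linear_add
      linear_diff linear_scale)

lemma bounded_clinear_id: "bounded_clinear id"
  by (simp add: bounded_clinear_def bounded_linear_ident id_def)

lemma bounded_clinear_compose: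
  "bounded_clinear A \<Longrightarrow> bounded_clinear B \<Longrightarrow> bounded_clinear (A \<circ> B)"
  unfolding bounded_clinear_def comp_def by (auto intro: bounded_linear_compose)

text \<open>Polarization recovers the real inner product from norms. The imaginary part follows by
  replacing x with i x, since A is complex linear.\<close>

lemma cinner_isometry:
  assumes A: "bounded_clinear A" and iso: "\<And>x. norm (A x) = norm x"
  shows "cinner (A x) (A y) = cinner x y"
proof -
  have re: "inner (A x) (A y) = inner x y" for x y
    by (simp add: dot_norm iso bounded_clinearD(2)[OF A, symmetric])
  show ?thesis
    using re[of x y] re[of "\<i> *\<^sub>C x" y]
    by (intro complex_eqI) (simp_all add: inner_eq_Re_cinner bounded_clinearD(4)[OF A] cinner_scaleC_left)
qed

text \<open>This form avoids the description behind \<open>cadjoint\<close> when unitaries are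
  built. Writing y = A (\<open>inv A y\<close>), the isometry property gives that <A x, y> equals
  <x, \<open>inv A y\<close>>, so the inverse is the adjoint.\<close>

lemma unitary_iff_surj_isometry:
  fixes A :: "'a::complex_hilbert_space \<Rightarrow> 'a"
  shows "unitary A \<longleftrightarrow> bounded_clinear A \<and> (\<forall>x. norm (A x) = norm x) \<and> surj A"
proof
  assume u: "unitary A"
  then have A: "bounded_clinear A" and l: "\<And>x. cadjoint A (A x) = x" and r: "\<And>x. A (cadjoint A x) = x"
    by (auto simp: unitary_def fun_eq_iff)
  have "norm (A x) = norm x" for x
  proof -
    have "complex_of_real ((norm (A x))\<^sup>2) = complex_of_real ((norm x)\<^sup>2)"
      by (simp only: cinner_same[symmetric] cinner_cadjoint[OF A] l)
    then have "(norm (A x))\<^sup>2 = (norm x)\<^sup>2"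
      using of_real_eq_iff by blast
    then show ?thesis by simp
  qed
  then show "bounded_clinear A \<and> (\<forall>x. norm (A x) = norm x) \<and> surj A"
    using A surjI[of A, OF r] by blast
next
  assume "bounded_clinear A \<and> (\<forall>x. norm (A x) = norm x) \<and> surj A"
  then have A: "bounded_clinear A" and iso: "\<forall>x. norm (A x) = norm x" and s: "surj A"
    by auto
  have r: "A (inv A y) = y" for y
    by (rule surj_f_inv_f[OF s])
  have "inj A"
  proof (rule injI)
    fix x y assume "A x = A y"
    then show "x = y"
      using iso[rule_format, of "x - y"] by (simp add: bounded_clinearD(3)[OF A])
  qed
  have "cadjoint A = inv A"
    by (rule cadjoint_eqI) (metis cinner_isometry[OF A iso[rule_format]] r)
  then show "unitary A"
    using A s \<open>inj A\<close> by (simp add: unitary_def surj_iff inj_iff)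
qed

lemma unitaryD:
  fixes A :: "'a::complex_hilbert_space \<Rightarrow> 'a"
  assumes "unitary A"
  shows "bounded_clinear A" "norm (A x) = norm x" "surj A" "cinner (A x) (A y) = cinner x y"
  using assms cinner_isometry[of A] unfolding unitary_iff_surj_isometry by blast+

section \<open>Adjoints and intertwining relations\<close>

lemma bounded_clinear_cadjoint:
  fixes A :: "'a::complex_hilbert_space \<Rightarrow> 'b::complex_inner"
  assumes A: "bounded_clinear A"
  shows "bounded_clinear (cadjoint A)"
proof -
  have add: "cadjoint A (x + y) = cadjoint A x + cadjoint A y" for x y
    by (rule cinner_eqI) (simp add: cinner_add_right cinner_cadjoint[OF A, symmetric])
  have scale: "cadjoint A (c *\<^sub>C x) = c *\<^sub>C cadjoint A x" for c x
    by (rule cinner_eqI) (simp add: cinner_scaleC_right cinner_cadjoint[OF A, symmetric])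
  have "cadjoint A (r *\<^sub>R x) = r *\<^sub>R cadjoint A x" for r x
    using scale[of "complex_of_real r" x] by (simp add: scaleC_of_real)
  moreover obtain K where "0 \<le> K" and K: "\<And>x. norm (A x) \<le> norm x * K"
    using bounded_linear.nonneg_bounded[OF bounded_clinearD(1)[OF A]] by blast
  have "norm (cadjoint A y) \<le> norm y * K" for y
  proof (cases "cadjoint A y = 0")
    case False
    have "norm (cadjoint A y) * norm (cadjoint A y) = cmod (cinner (cadjoint A y) (cadjoint A y))"
      unfolding cinner_same norm_of_real by (simp add: power2_eq_square)
    also have "\<dots> = cmod (cinner (A (cadjoint A y)) y)"
      by (simp add: cinner_cadjoint[OF A])
    also have "\<dots> \<le> norm (A (cadjoint A y)) * norm y"
      by (rule cmod_cinner_le)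
    also have "\<dots> \<le> norm (cadjoint A y) * K * norm y"
      using K by (rule mult_right_mono) simp
    finally have "norm (cadjoint A y) * norm (cadjoint A y) \<le> norm (cadjoint A y) * (norm y * K)"
      by (simp add: mult_ac)
    then show ?thesis
      using False by simp
  qed (simp add: \<open>0 \<le> K\<close>)
  ultimately show ?thesis
    unfolding bounded_clinear_def by (blast intro: bounded_linear_intro add scale)
qed

lemma cinner_eqI_surj:
  assumes "surj P" and eq: "\<And>x. cinner (P x) y = cinner (P x) z"
  shows "y = z"
proof (rule cinner_eqI)
  fix x
  obtain w where "x = P w"
    using \<open>surj P\<close> by blast
  then show "cinner x y = cinner x z"
    by (simp add: eq)
qed

text \<open>Taking adjoints in P S = T Q gives S* P* = Q* T*; multiplying by Q on the left and P on
  the right gives the other relation. The proof tests against vectors Q x or P y, which exhaust the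
  space.\<close>

lemma intertwine_cadjoint_iff:
  fixes S T P Q :: "'a::complex_hilbert_space \<Rightarrow> 'a"
  assumes S: "bounded_clinear S" and T: "bounded_clinear T" and P: "unitary P" and Q: "unitary Q"
  shows "P \<circ> S = T \<circ> Q \<longleftrightarrow> Q \<circ> cadjoint S = cadjoint T \<circ> P"
proof -
  have P_pair: "cinner (P (S x)) (P y) = cinner (Q x) (Q (cadjoint S y))" for x y
    by (simp add: unitaryD(4)[OF P] unitaryD(4)[OF Q] cinner_cadjoint[OF S])
  have T_pair: "cinner (T (Q x)) (P y) = cinner (Q x) (cadjoint T (P y))" for x y
    by (rule cinner_cadjoint[OF T])
  show ?thesis
  proof
    assume "P \<circ> S = T \<circ> Q"
    then have "P (S x) = T (Q x)" for x
      by (simp add: fun_eq_iff)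
    then have "cinner (Q x) (Q (cadjoint S y)) = cinner (Q x) (cadjoint T (P y))" for x y
      by (simp flip: P_pair T_pair)
    then have "Q (cadjoint S y) = cadjoint T (P y)" for y
      by (rule cinner_eqI_surj[OF unitaryD(3)[OF Q]])
    then show "Q \<circ> cadjoint S = cadjoint T \<circ> P" by auto
  next
    assume "Q \<circ> cadjoint S = cadjoint T \<circ> P"
    then have "Q (cadjoint S y) = cadjoint T (P y)" for y
      by (simp add: fun_eq_iff)
    then have "cinner (P y) (P (S x)) = cinner (P y) (T (Q x))" for x y
      by (metis P_pair T_pair cinner_commute)
    then have "P (S x) = T (Q x)" for x
      by (rule cinner_eqI_surj[OF unitaryD(3)[OF P]])
    then show "P \<circ> S = T \<circ> Q" by auto
  qed
qed

section \<open>Operators with dense range\<close>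

lemma eq_on_dense_range:
  fixes f g :: "'b::topological_space \<Rightarrow> 'c::real_normed_vector"
  assumes "closure (range A) = UNIV" "continuous_on UNIV f" "continuous_on UNIV g"
    and "\<And>x. f (A x) = g (A x)"
  shows "f = g"
proof
  fix y
  have "f y - g y = 0"
    by (rule continuous_constant_on_closure[where S = "range A" and f = "\<lambda>y. f y - g y"])
      (use assms in \<open>auto intro!: continuous_on_diff\<close>)
  then show "f y = g y" by simp
qed

lemma dense_range_compose:
  assumes A: "closure (range A) = UNIV" and B: "closure (range B) = UNIV"
    and cont: "continuous_on UNIV B"
  shows "closure (range (B \<circ> A)) = UNIV"
proof -
  have "B ` closure (range A) \<subseteq> closure (range (B \<circ> A))"
    using cont A closure_subset[of "range (B \<circ> A)"]
    by (intro image_closure_subset) auto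
  then have "closure (range B) \<subseteq> closure (range (B \<circ> A))"
    unfolding A by (intro closure_minimal) auto
  then show ?thesis using B by auto
qed

text \<open>The best approximations of \<open>z\<close> by the range of the adjoint converge to some \<open>w\<close>, and
  \<open>z - w\<close> is orthogonal to this range, hence in the kernel of \<open>A\<close>.\<close>

lemma dense_range_cadjoint:
  fixes A :: "'a::complex_hilbert_space \<Rightarrow> 'b::complex_inner"
  assumes A: "bounded_clinear A" and inj: "inj A"
  shows "closure (range (cadjoint A)) = UNIV"
proof -
  note B = bounded_clinear_cadjoint[OF A]
  have "z \<in> closure (range (cadjoint A))" for z
  proof -
    define q where "q y = (norm (z - cadjoint A y))\<^sup>2" for y
    define d where "d = Inf (range q)"
    have d_le: "d \<le> q y" for y
      unfolding d_def by (intro cInf_lower bdd_belowI[of _ 0]) (auto simp: q_def)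
    have "\<exists>y. q y < d + 1 / real (Suc n)" for n
      using cInf_lessD[of "range q" "d + 1 / real (Suc n)"] by (auto simp: d_def)
    then obtain Y where Y: "\<And>n. q (Y n) < d + 1 / real (Suc n)"
      by metis
    have half: "cadjoint A ((1/2) *\<^sub>R (x + y)) = (1/2) *\<^sub>R (cadjoint A x + cadjoint A y)" for x y
      by (simp add: bounded_clinearD(2,6)[OF B])
    \<comment> \<open>Parallelogram law: the midpoint cannot beat the infimum d, so two
      near-minimizers have images close to each other.\<close>
    have par: "(norm (cadjoint A x - cadjoint A y))\<^sup>2 \<le> 2 * (q x - d) + 2 * (q y - d)" for x y
    proof -
      have "q ((1/2) *\<^sub>R (x + y)) = (q x + q y) / 2 - (norm (cadjoint A x - cadjoint A y))\<^sup>2 / 4"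
        unfolding q_def half
        by (simp add: power2_norm_eq_inner inner_add inner_diff inner_commute field_simps)
      then show ?thesis
        using d_le[of "(1/2) *\<^sub>R (x + y)"] by argo
    qed
    have "Cauchy (\<lambda>n. cadjoint A (Y n))"
    proof (rule metric_CauchyI)
      fix e :: real assume "e > 0"
      then obtain N where "inverse (real (Suc N)) < e\<^sup>2 / 4"
        using reals_Archimedean[of "e\<^sup>2 / 4"] by auto
      then have small: "q (Y n) - d < e\<^sup>2 / 4" if "n \<ge> N" for n
        using Y[of n] that inverse_of_nat_le[of "Suc N" "Suc n", where 'a = real]
        by (simp add: inverse_eq_divide)
      have "dist (cadjoint A (Y i)) (cadjoint A (Y j)) < e" if "i \<ge> N" "j \<ge> N" for i j
      proof -
        have "(norm (cadjoint A (Y i) - cadjoint A (Y j)))\<^sup>2 < e\<^sup>2"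
          using par[of "Y i" "Y j"] small[OF that(1)] small[OF that(2)] by argo
        then show ?thesis
          using \<open>e > 0\<close> by (simp add: dist_norm power_less_imp_less_base)
      qed
      then show "\<exists>N. \<forall>i\<ge>N. \<forall>j\<ge>N. dist (cadjoint A (Y i)) (cadjoint A (Y j)) < e" by blast
    qed
    then obtain w where w: "(\<lambda>n. cadjoint A (Y n)) \<longlonglongrightarrow> w"
      using Cauchy_convergent convergent_def by blast
    \<comment> \<open>Each \<open>Y n + v\<close> is also a competitor, so moving w within the range
      of the adjoint brings it no closer to z.\<close>
    have w_le: "(norm (z - w))\<^sup>2 \<le> (norm (z - w - cadjoint A v))\<^sup>2" for v
    proof (rule LIMSEQ_le)
      have "(\<lambda>n. q (Y n)) \<longlonglongrightarrow> (norm (z - w))\<^sup>2"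
        unfolding q_def by (intro tendsto_intros w)
      from tendsto_diff[OF this LIMSEQ_inverse_real_of_nat]
      show "(\<lambda>n. q (Y n) - 1 / real (Suc n)) \<longlonglongrightarrow> (norm (z - w))\<^sup>2"
        by (simp add: inverse_eq_divide)
      show "(\<lambda>n. q (Y n + v)) \<longlonglongrightarrow> (norm (z - w - cadjoint A v))\<^sup>2"
        unfolding q_def bounded_clinearD(2)[OF B] diff_diff_add by (intro tendsto_intros w)
      show "\<exists>N. \<forall>n\<ge>N. q (Y n) - 1 / real (Suc n) \<le> q (Y n + v)"
      proof (intro exI allI impI)
        show "q (Y n) - 1 / real (Suc n) \<le> q (Y n + v)" for n
          using Y[of n] d_le[of "Y n + v"] by linarith
      qed
    qed
    have "inner (z - w) (cadjoint A v) = 0" for v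
    proof (rule ccontr)
      assume ne: "inner (z - w) (cadjoint A v) \<noteq> 0"
      define c where "c = inner (z - w) (cadjoint A v)"
      \<comment> \<open>The step t = c / s turns minimality into 2 c^2 / s <= c^2 / s. The summand 1
        keeps s positive even if \<open>cadjoint A v\<close> vanishes.\<close>
      define s where "s = (norm (cadjoint A v))\<^sup>2 + 1"
      have "s > 0" by (simp add: s_def add_nonneg_pos)
      have "(norm (z - w - cadjoint A (t *\<^sub>R v)))\<^sup>2
          = (norm (z - w))\<^sup>2 - 2 * t * c + t\<^sup>2 * (norm (cadjoint A v))\<^sup>2" for t
        unfolding c_def bounded_clinearD(6)[OF B] power2_norm_eq_inner
        by (simp add: inner_diff inner_commute power2_eq_square algebra_simps)
      then have "2 * (c / s) * c \<le> (c / s)\<^sup>2 * (norm (cadjoint A v))\<^sup>2"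
        using w_le[of "(c / s) *\<^sub>R v"] by simp
      also have "\<dots> \<le> (c / s)\<^sup>2 * s"
        by (intro mult_left_mono) (auto simp: s_def)
      also have "\<dots> = (c / s) * c"
        using \<open>s > 0\<close> by (simp add: power2_eq_square)
      finally have "c * c / s \<le> 0" by simp
      moreover have "c * c / s > 0"
        using ne \<open>s > 0\<close> by (simp add: c_def flip: power2_eq_square)
      ultimately show False by simp
    qed
    \<comment> \<open>Orthogonality is applied with v = \<open>A (z - w)\<close>.\<close>
    then have "inner (A (z - w)) (A (z - w)) = 0"
      by (simp add: inner_eq_Re_cinner cinner_cadjoint[OF A])
    then have "A z = A w"
      by (simp add: bounded_clinearD(3)[OF A])
    then have "z = w"
      using inj by (simp add: inj_eq)
    with w show ?thesis
      unfolding closure_sequential by (intro exI[of _ "\<lambda>n. cadjoint A (Y n)"]) simp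
  qed
  then show ?thesis by auto
qed

section \<open>Extending isometries from dense ranges\<close>

lemma continuous_on_scaleC:
  fixes f :: "'a::topological_space \<Rightarrow> 'b::complex_inner"
  assumes "continuous_on X f"
  shows "continuous_on X (\<lambda>x. a *\<^sub>C f x)"
proof -
  have scaleR: "a *\<^sub>C r *\<^sub>R x = r *\<^sub>R a *\<^sub>C x" for r and x :: 'b
    by (simp add: scaleC_scaleC mult.commute flip: scaleC_of_real)
  have "bounded_linear (\<lambda>x::'b. a *\<^sub>C x)"
    by (rule bounded_linear_intro[where K = "cmod a"])
      (simp_all add: scaleC_add_right norm_scaleC scaleR)
  then show ?thesis
    using assms by (rule bounded_linear.continuous_on)
qed

text \<open>The assignment of B x to A x preserves distances, hence is well defined and uniformly
  continuous, and extends because the target is complete. Its algebraic identities extend by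
  density.\<close>

lemma isometry_extension:
  fixes A :: "'a::complex_inner \<Rightarrow> 'b::complex_inner" and B :: "'a \<Rightarrow> 'c::complex_hilbert_space"
  assumes A: "bounded_clinear A" and B: "bounded_clinear B"
    and dense: "closure (range A) = UNIV" and norm: "\<And>x. norm (A x) = norm (B x)"
  obtains W where "bounded_clinear W" "\<And>x. norm (W x) = norm x" "\<And>x. W (A x) = B x"
proof -
  have dist: "dist (B x) (B y) = dist (A x) (A y)" for x y
    by (simp add: dist_norm norm bounded_clinearD(3)[OF A, symmetric]
        bounded_clinearD(3)[OF B, symmetric])
  \<comment> \<open>The preimage chosen by \<open>inv A\<close> does not matter: \<open>dist\<close>
    shows that points with the same image under A have the same image under B.\<close>
  define f where "f = B \<circ> inv A"
  have f: "f (A x) = B x" for x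
    using dist[of "inv A (A x)" x] by (simp add: f_def f_inv_into_f[of "A x" A UNIV])
  have "uniformly_continuous_on (range A) f"
    unfolding uniformly_continuous_on_def by (auto simp: f dist)
  from uniformly_continuous_on_extension_on_closure[OF this]
  obtain W where W: "uniformly_continuous_on (closure (range A)) W"
    and Wf: "\<And>x. x \<in> range A \<Longrightarrow> f x = W x"
    by metis
  have WA: "W (A x) = B x" for x
    using Wf[of "A x"] by (simp add: f)
  have cont: "continuous_on UNIV W"
    using W by (simp add: dense uniformly_continuous_imp_continuous)
  have W_cont: "continuous_on UNIV (\<lambda>x. W (h x))" if "continuous_on UNIV h" for h :: "'b \<Rightarrow> 'b"
    using continuous_on_compose2[OF cont that] by simp
  note cont_intros = W_cont continuous_on_scaleC continuous_on_add continuous_on_norm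
    continuous_on_id continuous_on_const
  have "(\<lambda>y. norm (W y)) = norm"
    by (rule eq_on_dense_range[OF dense]; (intro cont_intros continuous_on_norm_id)?; simp add: WA norm)
  then have W_norm: "norm (W y) = norm y" for y
    by (rule fun_cong)
  \<comment> \<open>Additivity is extended one argument at a time: first z leaves the range of A,
    then the other summand does.\<close>
  have "(\<lambda>z. W (A x + z)) = (\<lambda>z. W (A x) + W z)" for x
    by (rule eq_on_dense_range[OF dense]; (intro cont_intros)?)
      (simp add: WA bounded_clinearD(2)[OF B] flip: bounded_clinearD(2)[OF A])
  then have "(\<lambda>y. W (y + z)) = (\<lambda>y. W y + W z)" for z
    by (intro eq_on_dense_range[OF dense] cont_intros) (rule fun_cong)
  then have W_add: "W (y + z) = W y + W z" for y z
    by (rule fun_cong)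
  have "(\<lambda>y. W (a *\<^sub>C y)) = (\<lambda>y. a *\<^sub>C W y)" for a
    by (rule eq_on_dense_range[OF dense]; (intro cont_intros)?)
      (simp add: WA bounded_clinearD(4)[OF B] flip: bounded_clinearD(4)[OF A])
  then have W_scale: "W (a *\<^sub>C y) = a *\<^sub>C W y" for a y
    by (rule fun_cong)
  have "W (r *\<^sub>R y) = r *\<^sub>R W y" for r y
    using W_scale[of "complex_of_real r" y] by (simp add: scaleC_of_real)
  then have "bounded_clinear W"
    unfolding bounded_clinear_def
    by (auto intro!: bounded_linear_intro[where K = 1] simp: W_add W_scale W_norm)
  from this W_norm WA show thesis by (rule that)
qed

text \<open>Extending the inverse assignment as well gives W' with W W' = id on the dense range of
  B, hence everywhere, so the isometry W is surjective.\<close>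

lemma unitary_extension:
  fixes A B :: "'a::complex_hilbert_space \<Rightarrow> 'a"
  assumes A: "bounded_clinear A" and B: "bounded_clinear B"
    and dense: "closure (range A) = UNIV" "closure (range B) = UNIV"
    and norm: "\<And>x. norm (A x) = norm (B x)"
  obtains W where "unitary W" "\<And>x. W (A x) = B x"
proof -
  obtain W where W: "bounded_clinear W" "\<And>x. norm (W x) = norm x" "\<And>x. W (A x) = B x"
    using isometry_extension[OF A B dense(1) norm] by blast
  obtain W' where W': "bounded_clinear W'" "\<And>x. norm (W' x) = norm x" "\<And>x. W' (B x) = A x"
    using isometry_extension[OF B A dense(2) norm[symmetric]] by blast
  have "W \<circ> W' = id"
  proof (rule eq_on_dense_range[OF dense(2)])
    show "continuous_on UNIV (W \<circ> W')"
      by (rule bounded_clinearD(5)[OF bounded_clinear_compose[OF W(1) W'(1)]])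
    show "continuous_on UNIV (id :: 'a \<Rightarrow> 'a)"
      by (rule continuous_on_id')
    show "(W \<circ> W') (B x) = id (B x)" for x
      by (simp add: W(3) W'(3))
  qed
  then have "surj W"
    by (metis comp_apply id_apply surjI)
  then have "unitary W"
    using W(1,2) unfolding unitary_iff_surj_isometry by blast
  from this W(3) show thesis by (rule that)
qed

text \<open>A chain W carries the n-fold product of the A's to that of the B's after V, so the norms
  agree. Conversely, equal norms give each \<open>W n\<close> separately by
  \<open>unitary_extension\<close>, and neighbours are compatible by density. It serves both the
  weights from k upwards and the adjoint weights below k.\<close>

lemma one_sided_intertwiners_iff:
  fixes A B :: "nat \<Rightarrow> 'a::complex_hilbert_space \<Rightarrow> 'a"
  assumes A: "\<And>n. bounded_clinear (A n)" "\<And>n. closure (range (A n)) = UNIV"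
    and B: "\<And>n. bounded_clinear (B n)" "\<And>n. closure (range (B n)) = UNIV"
    and V: "unitary V"
  shows "(\<forall>n\<ge>1. \<forall>x. norm (fold A [0..<n] x) = norm (fold B [0..<n] (V x))) \<longleftrightarrow>
    (\<exists>W. W 0 = V \<and> (\<forall>n. unitary (W n) \<and> W (Suc n) \<circ> A n = B n \<circ> W n))"
proof
  assume "\<exists>W. W 0 = V \<and> (\<forall>n. unitary (W n) \<and> W (Suc n) \<circ> A n = B n \<circ> W n)"
  then obtain W where W: "W 0 = V" "\<And>n. unitary (W n)" "\<And>n x. W (Suc n) (A n x) = B n (W n x)"
    by (auto simp: fun_eq_iff)
  have "W n (fold A [0..<n] x) = fold B [0..<n] (V x)" for n x
    by (induction n) (simp_all add: W)
  then show "\<forall>n\<ge>1. \<forall>x. norm (fold A [0..<n] x) = norm (fold B [0..<n] (V x))"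
    by (metis unitaryD(2) W(2))
next
  have fold: "bounded_clinear (fold C [0..<n]) \<and> closure (range (fold C [0..<n])) = UNIV"
    if "\<And>n. bounded_clinear (C n)" "\<And>n. closure (range (C n)) = UNIV"
    for C :: "nat \<Rightarrow> 'a \<Rightarrow> 'a" and n
  proof (induction n)
    case (Suc n)
    then have "bounded_clinear (C n \<circ> fold C [0..<n])"
      and "closure (range (C n \<circ> fold C [0..<n])) = UNIV"
      using bounded_clinear_compose[OF that(1)]
        dense_range_compose[OF _ that(2) bounded_clinearD(5)[OF that(1)]] by blast+
    then show ?case by (simp add: comp_def)
  qed (simp add: bounded_clinear_id[unfolded id_def])
  assume norm: "\<forall>n\<ge>1. \<forall>x. norm (fold A [0..<n] x) = norm (fold B [0..<n] (V x))"
  \<comment> \<open>The norm hypothesis starts at n = 1; for n = 0 the products are empty and V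
    itself is the witness.\<close>
  have "\<exists>W. unitary W \<and> (\<forall>x. W (fold A [0..<n] x) = fold B [0..<n] (V x))" for n
  proof (cases n)
    case (Suc n')
    have dense_V: "closure (range V) = UNIV"
      using unitaryD(3)[OF V] by simp
    obtain W where "unitary W" "\<And>x. W (fold A [0..<n] x) = (fold B [0..<n] \<circ> V) x"
    proof (rule unitary_extension)
      show "bounded_clinear (fold A [0..<n])" "closure (range (fold A [0..<n])) = UNIV"
        using fold[of A, OF A] by blast+
      show "bounded_clinear (fold B [0..<n] \<circ> V)"
        using fold[of B, OF B] unitaryD(1)[OF V] bounded_clinear_compose by blast
      show "closure (range (fold B [0..<n] \<circ> V)) = UNIV"
        using fold[of B, OF B] by (intro dense_range_compose dense_V bounded_clinearD(5)) blast+
      show "norm (fold A [0..<n] x) = norm ((fold B [0..<n] \<circ> V) x)" for x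
        unfolding comp_def by (rule norm[rule_format]) (use Suc in simp)
    qed blast
    then show ?thesis by auto
  qed (use V in auto)
  then obtain W where W: "\<And>n. unitary (W n)" "\<And>n x. W n (fold A [0..<n] x) = fold B [0..<n] (V x)"
    by metis
  have "W 0 = V"
    using W(2)[of 0] by auto
  \<comment> \<open>On the dense range of the n-fold product, both sides take the value
    \<open>fold B [0..<Suc n] (V x)\<close>.\<close>
  moreover have "W (Suc n) \<circ> A n = B n \<circ> W n" for n
  proof (rule eq_on_dense_range)
    show "closure (range (fold A [0..<n])) = UNIV"
      using fold[of A, OF A] by blast
    show "continuous_on UNIV (W (Suc n) \<circ> A n)" "continuous_on UNIV (B n \<circ> W n)"
      by (intro bounded_clinearD(5) bounded_clinear_compose A B unitaryD(1) W)+
    show "(W (Suc n) \<circ> A n) (fold A [0..<n] x) = (B n \<circ> W n) (fold A [0..<n] x)" for x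
      using W(2)[of "Suc n" x] W(2)[of n x] by simp
  qed
  ultimately show "\<exists>W. W 0 = V \<and> (\<forall>n. unitary (W n) \<and> W (Suc n) \<circ> A n = B n \<circ> W n)"
    using W(1) by blast
qed

section \<open>Unitary operators of diagonal form\<close>

lemma onorm_unitary_le:
  fixes A :: "'a::complex_hilbert_space \<Rightarrow> 'a"
  shows "unitary A \<Longrightarrow> onorm A \<le> 1"
  by (rule onorm_bound) (simp_all add: unitaryD)

lemma bij_plus_int: "bij (\<lambda>n. n + j :: int)"
  by (rule bij_betw_byWitness[where f' = "\<lambda>n. n - j"]) auto

text \<open>Used with j = m for the intertwiner and with j = 0 for its diagonal factor. Norm and
  surjectivity reduce to single coordinates, as reindexing by j preserves the sum of
  squares.\<close>

lemma unitary_ell2Z: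
  fixes V :: "int \<Rightarrow> 'a::complex_hilbert_space \<Rightarrow> 'a"
  assumes V: "\<And>n. unitary (V n)"
  obtains U where "unitary U" "\<And>x n. coord (U x) n = V n (coord x (n + j))"
proof -
  define U where "U x = Abs_ell2Z (\<lambda>n. V n (coord x (n + j)))" for x
  have U: "coord (U x) n = V n (coord x (n + j))" for x n
  proof -
    have "(\<lambda>n. (norm (coord x (n + j)))\<^sup>2) summable_on UNIV"
      using summable_on_reindex_bij_betw[OF bij_plus_int, of "\<lambda>n. (norm (coord x n))\<^sup>2"]
        summable_coord by blast
    then show ?thesis
      by (simp add: U_def Abs_ell2Z_inverse unitaryD(2)[OF V])
  qed
  have "bdd_above (range (\<lambda>n. onorm (V n)))"
    using onorm_unitary_le[OF V] unfolding bdd_above_def by auto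
  then have "bounded_clinear U"
    by (rule bounded_clinear_ell2Z_I[OF U bij_plus_int unitaryD(1)[OF V]])
  moreover have "norm (U x) = norm x" for x
  proof -
    have "(norm (U x))\<^sup>2 = (\<Sum>\<^sub>\<infinity>n. (norm (coord x (n + j)))\<^sup>2)"
      by (simp add: norm_ell2Z_square U unitaryD(2)[OF V])
    also have "\<dots> = (norm x)\<^sup>2"
      unfolding norm_ell2Z_square by (rule infsum_reindex_bij_betw[OF bij_plus_int])
    finally show ?thesis by simp
  qed
  moreover have "\<exists>x. U x = y" for y
  proof -
    \<comment> \<open>Solves V_n z_(n+j) = y_n after the index change from n to n - j.\<close>
    define z where "z n = inv (V (n - j)) (coord y (n - j))" for n
    have z: "V n (z (n + j)) = coord y n" for n
      by (simp add: z_def surj_f_inv_f unitaryD(3)[OF V])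
    have "norm (z n) = norm (coord y (n - j))" for n
      using z[of "n - j"] unitaryD(2)[OF V, of "n - j" "z n"] by simp
    moreover have "(\<lambda>n. (norm (coord y (n - j)))\<^sup>2) summable_on UNIV"
      using summable_on_reindex_bij_betw[OF bij_plus_int[of "- j"], of "\<lambda>n. (norm (coord y n))\<^sup>2"]
        summable_coord[of y] by simp
    ultimately have "coord (Abs_ell2Z z) = z"
      by (intro Abs_ell2Z_inverse) simp
    then show ?thesis
      by (intro exI[of _ "Abs_ell2Z z"] ell2Z_eqI) (simp add: U z)
  qed
  ultimately have "unitary U"
    unfolding unitary_iff_surj_isometry surj_def by metis
  with U show thesis by (intro that)
qed

section \<open>Intertwiners read off from vectors supported at one index\<close>

lemma coord_single: "coord (ell2Z_single j h) n = (if n = j then h else 0)"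
  by (simp add: ell2Z_single.rep_eq)

lemma norm_single: "norm (ell2Z_single j h) = norm h"
proof -
  have "(norm (ell2Z_single j h))\<^sup>2 = (\<Sum>\<^sub>\<infinity>n\<in>{j}. (norm h)\<^sup>2)"
    unfolding norm_ell2Z_square by (rule infsum_cong_neutral) (auto simp: coord_single)
  then show ?thesis by simp
qed

text \<open>The nonzero entry fixes the power of the shift in U. Since U then permutes the summands,
  unitarity and intertwining can be checked on each summand separately.\<close>

lemma diagonal_intertwiner_iff:
  fixes S T :: "'a::complex_hilbert_space ell2Z \<Rightarrow> 'a ell2Z"
  assumes ne: "\<exists>h::'a. h \<noteq> 0"
    and S: "is_weighted_shift S Sw" and T: "is_weighted_shift T Tw"
  shows "(\<exists>U. unitary U \<and> of_diagonal_form U \<and> U \<circ> S = T \<circ> U \<and> matrix_entry U 0 m \<noteq> (\<lambda>_. 0)) \<longleftrightarrow>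
    (\<exists>V. \<forall>n. unitary (V n) \<and> V n \<circ> Sw (n + m) = Tw n \<circ> V (n - 1))"
proof -
  have cS: "coord (S x) n = Sw n (coord x (n - 1))" and cT: "coord (T x) n = Tw n (coord x (n - 1))" for x n
    using S T by (auto simp: is_weighted_shift_def)
  show ?thesis
  proof
    assume "\<exists>U. unitary U \<and> of_diagonal_form U \<and> U \<circ> S = T \<circ> U \<and> matrix_entry U 0 m \<noteq> (\<lambda>_. 0)"
    then obtain U j D where U: "unitary U" "U \<circ> S = T \<circ> U" "matrix_entry U 0 m \<noteq> (\<lambda>_. 0)"
      and D: "is_diagonal D" "U = int_funpow Fshift j \<circ> D"
      unfolding of_diagonal_form_def by blast
    from D(1) obtain W where W: "\<And>n. bounded_clinear (W n)" "\<And>x n. coord (D x) n = W n (coord x n)"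
      unfolding is_diagonal_def by blast
    have W0: "W n 0 = 0" for n
      using bounded_clinearD(3)[OF W(1), of n 0 0] by simp
    obtain h where "coord (U (ell2Z_single m h)) 0 \<noteq> 0"
      using U(3) by (auto simp: matrix_entry_def fun_eq_iff)
    \<comment> \<open>Coordinate 0 of U x depends only on coordinate -j of x, so a vector supported
      at m is seen there only if -j = m.\<close>
    then have j: "j = - m"
      by (simp add: D(2) coord_int_funpow_Fshift W(2) W0 coord_single split: if_splits)
    define V where "V n = W (n + m)" for n
    have cU: "coord (U x) n = V n (coord x (n + m))" for x n
      by (simp add: D(2) coord_int_funpow_Fshift W(2) j V_def)
    have V: "bounded_clinear (V n)" "V n 0 = 0" for n
      by (simp_all add: V_def W W0)
    \<comment> \<open>U maps summand n + m into summand n through \<open>V n\<close>, so each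
      \<open>V n\<close> inherits isometry from U.\<close>
    have U_single: "U (ell2Z_single (n + m) h) = ell2Z_single n (V n h)" for n h
      by (rule ell2Z_eqI) (simp add: cU coord_single V)
    have "norm (V n h) = norm h" for n h
      using unitaryD(2)[OF U(1), of "ell2Z_single (n + m) h"] by (simp add: U_single norm_single)
    moreover have "\<exists>h'. V n h' = h" for n h
    proof -
      obtain x where "ell2Z_single n h = U x"
        using unitaryD(3)[OF U(1)] by blast
      then have "h = V n (coord x (n + m))"
        using cU[of x n] by (metis coord_single)
      then show ?thesis by blast
    qed
    ultimately have "unitary (V n)" for n
      unfolding unitary_iff_surj_isometry surj_def using V(1) by metis
    moreover have "V n \<circ> Sw (n + m) = Tw n \<circ> V (n - 1)" for n
    proof
      fix h
      show "(V n \<circ> Sw (n + m)) h = (Tw n \<circ> V (n - 1)) h"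
        \<comment> \<open>A vector in summand n + m - 1 reaches summand n either through n + m
          (first S, then U) or through n - 1 (first U, then T).\<close>
        using arg_cong[OF fun_cong[OF U(2), of "ell2Z_single (n + m - 1) h"], of "\<lambda>x. coord x n"]
        by (simp add: cU cS cT coord_single algebra_simps)
    qed
    ultimately show "\<exists>V. \<forall>n. unitary (V n) \<and> V n \<circ> Sw (n + m) = Tw n \<circ> V (n - 1)"
      by blast
  next
    assume "\<exists>V. \<forall>n. unitary (V n) \<and> V n \<circ> Sw (n + m) = Tw n \<circ> V (n - 1)"
    then obtain V where V: "\<And>n. unitary (V n)" "\<And>n h. V n (Sw (n + m) h) = Tw n (V (n - 1) h)"
      by (auto simp: fun_eq_iff)
    obtain U where U: "unitary U" "\<And>x n. coord (U x) n = V n (coord x (n + m))"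
      using unitary_ell2Z[of V m] V(1) by blast
    \<comment> \<open>Composing with the shift power -m reads coordinate n + m of D x, so the weight
      of D there must be \<open>V n\<close>.\<close>
    obtain D where D: "unitary D" "\<And>x n. coord (D x) n = V (n - m) (coord x (n + 0))"
      using unitary_ell2Z[of "\<lambda>n. V (n - m)" 0] V(1) by blast
    have "is_diagonal D"
      unfolding is_diagonal_def using D unitaryD(1)[OF V(1)] onorm_unitary_le[OF V(1)]
      by (auto intro!: unitaryD(1)[OF D(1)] exI[of _ "\<lambda>n. V (n - m)"] bdd_aboveI[of _ 1])
    moreover have "U = int_funpow Fshift (- m) \<circ> D"
      by (rule ext, rule ell2Z_eqI) (simp add: coord_int_funpow_Fshift U D)
    ultimately have "of_diagonal_form U"
      unfolding of_diagonal_form_def by blast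
    moreover have "U \<circ> S = T \<circ> U"
      by (rule ext, rule ell2Z_eqI) (simp add: U cS cT V(2) algebra_simps)
    moreover have "matrix_entry U 0 m \<noteq> (\<lambda>_. 0)"
    proof
      assume 0: "matrix_entry U 0 m = (\<lambda>_. 0)"
      obtain h :: 'a where "h \<noteq> 0" using ne by blast
      then show False
        \<comment> \<open>The entry at (0, m) is \<open>V 0\<close>, which preserves the norm of
          h.\<close>
        using fun_cong[OF 0, of h] unitaryD(2)[OF V(1), of 0 h]
        by (simp add: matrix_entry_def U coord_single)
    qed
    ultimately show "\<exists>U. unitary U \<and> of_diagonal_form U \<and> U \<circ> S = T \<circ> U \<and> matrix_entry U 0 m \<noteq> (\<lambda>_. 0)"
      using U(1) by blast
  qed
qed

section \<open>Products of weights\<close>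

text \<open>\<open>fold\<close> applies the lowest index first, so the leftmost factor of the
  operator product has the highest index.\<close>

lemma fold_upto_int: "fold f [a..a + int n - 1] = fold (\<lambda>i. f (a + int i)) [0..<n]"
proof (induction n)
  case (Suc n)
  have "[a..a + int (Suc n) - 1] = [a..a + int n - 1] @ [a + int n]"
    using upto_rec2[of a "a + int n"] by simp
  then show ?case using Suc by simp
qed simp

text \<open>\<open>foldr\<close> applies the last list element first. This is the descending order
  of the adjoint products, now counted from 0 as \<open>one_sided_intertwiners_iff\<close>
  requires.\<close>

lemma foldr_upto_int: "foldr f [a - int n + 1..a] = fold (\<lambda>i. f (a - int i)) [0..<n]"
proof (induction n)
  case (Suc n)
  have "[a - int (Suc n) + 1..a] = (a - int n) # [a - int n + 1..a]"
    using upto_rec1[of "a - int n" a] by simp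
  then show ?case using Suc by simp
qed simp

theorem corollary2p4:
  fixes S T :: "'h::complex_hilbert_space ell2Z \<Rightarrow> 'h ell2Z"
    and Sw Tw :: "int \<Rightarrow> 'h \<Rightarrow> 'h"
    and m :: int
  assumes "\<exists>h::'h. h \<noteq> 0"
    and "is_weighted_shift S Sw" and "\<And>n. quasi_invertible (Sw n)"
    and "is_weighted_shift T Tw" and "\<And>n. quasi_invertible (Tw n)"
  shows "(\<exists>U. unitary U \<and> of_diagonal_form U \<and> U \<circ> S = T \<circ> U \<and>
            matrix_entry U 0 m \<noteq> (\<lambda>_. 0)) \<longleftrightarrow>
         (\<exists>k V. unitary V \<and>
            (\<forall>x. \<forall>n::nat. n \<ge> 1 \<longrightarrow>
               norm (fold Sw [m + k..m + int n + k - 1] x) =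
               norm (fold Tw [k..int n + k - 1] (V x))) \<and>
            (\<forall>x. \<forall>n::nat. n \<ge> 1 \<longrightarrow>
               norm (foldr (\<lambda>i. cadjoint (Sw i)) [m - int n + k..m - 1 + k] x) =
               norm (foldr (\<lambda>i. cadjoint (Tw i)) [- int n + k..- 1 + k] (V x))))"
proof -
  have bc: "bounded_clinear (Sw n)" "bounded_clinear (Tw n)"
    and inj: "inj (Sw n)" "inj (Tw n)"
    and dense: "closure (range (Sw n)) = UNIV" "closure (range (Tw n)) = UNIV" for n
    using assms(3)[of n] assms(5)[of n] by (auto simp: quasi_invertible_def)
  \<comment> \<open>The two-sided family is cut at index k - 1: \<open>P n\<close> stands for
    V_(k-1+n) and \<open>Q n\<close> for V_(k-1-n). Below the cut the relations are passed to
    adjoints so that they too can be iterated away from it.\<close>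
  have chain: "(\<exists>V. \<forall>n. unitary (V n) \<and> V n \<circ> Sw (n + m) = Tw n \<circ> V (n - 1)) \<longleftrightarrow> (\<exists>k V. unitary V \<and>
      (\<exists>P. P 0 = V \<and> (\<forall>n. unitary (P n) \<and> P (Suc n) \<circ> Sw (m + k + int n) = Tw (k + int n) \<circ> P n)) \<and>
      (\<exists>Q. Q 0 = V \<and> (\<forall>n. unitary (Q n) \<and> Q (Suc n) \<circ> cadjoint (Sw (m + k - 1 - int n)) =
        cadjoint (Tw (k - 1 - int n)) \<circ> Q n)))"
    (is "(\<exists>V. ?chain V) \<longleftrightarrow> (\<exists>k V. unitary V \<and> (\<exists>P. ?fwd k V P) \<and> (\<exists>Q. ?bwd k V Q))")
  proof safe
    fix V assume V: "?chain V"
    \<comment> \<open>Any cut works in this direction; k = 0 is chosen, so the common starting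
      unitary is V_(-1).\<close>
    have fwd: "?fwd 0 (V (- 1)) (\<lambda>n. V (int n - 1))"
      using V by (auto simp: add.commute)
    have bwd: "?bwd 0 (V (- 1)) (\<lambda>n. V (- 1 - int n))"
    proof (intro conjI allI)
      fix n
      show "V (- 1 - int (Suc n)) \<circ> cadjoint (Sw (m + 0 - 1 - int n)) =
        cadjoint (Tw (0 - 1 - int n)) \<circ> V (- 1 - int n)"
        \<comment> \<open>The relation at -1 - n is dualized; the instance at -2 - n supplies the
          unitarity of the second operator.\<close>
        using V[rule_format, of "- 1 - int n"] V[rule_format, of "- 2 - int n"]
          intertwine_cadjoint_iff[OF bc, of "V (- 1 - int n)" "V (- 2 - int n)" "m - 1 - int n" "- 1 - int n"]
        by (simp add: algebra_simps minus_diff_commute[of _ 2])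
    qed (use V in auto)
    show "\<exists>k V. unitary V \<and> (\<exists>P. ?fwd k V P) \<and> (\<exists>Q. ?bwd k V Q)"
      using V[rule_format, of "- 1"] exI[of "?fwd 0 (V (- 1))", OF fwd]
        exI[of "?bwd 0 (V (- 1))", OF bwd] by blast
  next
    fix k P Q
    assume P: "\<forall>n. unitary (P n) \<and> P (Suc n) \<circ> Sw (m + k + int n) = Tw (k + int n) \<circ> P n"
      and Q: "\<forall>n. unitary (Q n) \<and> Q (Suc n) \<circ> cadjoint (Sw (m + k - 1 - int n)) =
        cadjoint (Tw (k - 1 - int n)) \<circ> Q n" and eq: "Q 0 = P 0"
    \<comment> \<open>The two halves overlap at n = k - 1, where \<open>eq\<close> says that they
      agree.\<close>
    define V where "V n = (if n \<ge> k - 1 then P (nat (n - k + 1)) else Q (nat (k - 1 - n)))" for n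
    have u: "unitary (V n)" for n
      using P Q by (simp add: V_def)
    have "V n \<circ> Sw (n + m) = Tw n \<circ> V (n - 1)" for n
    proof (cases "n \<ge> k")
      case True
      define i where "i = nat (n - k)"
      have i: "n = k + int i" using True by (simp add: i_def)
      have "V n = P (Suc i)" "V (n - 1) = P i"
        by (simp_all add: V_def i Suc_nat_eq_nat_zadd1 nat_add_distrib)
      then show ?thesis
        using P by (simp add: i algebra_simps)
    next
      case False
      define i where "i = nat (k - 1 - n)"
      have i: "n = k - 1 - int i" using False by (simp add: i_def)
      \<comment> \<open>For i = 0 the definition yields \<open>P 0\<close>, which \<open>eq\<close>
        replaces by \<open>Q 0\<close>; hence the case split on i.\<close>
      have "V n = Q i" "V (n - 1) = Q (Suc i)"
        using eq by (cases i; simp add: V_def i nat_add_distrib)+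
      then show ?thesis
        using Q[rule_format, of i] intertwine_cadjoint_iff[OF bc u u, of n "n + m" n "n - 1"]
        by (simp add: i algebra_simps)
    qed
    with u show "\<exists>V. ?chain V" by blast
  qed
  have fold_eq: "fold Sw [m + k..m + int n + k - 1] = fold (\<lambda>i. Sw (m + k + int i)) [0..<n]"
    "fold Tw [k..int n + k - 1] = fold (\<lambda>i. Tw (k + int i)) [0..<n]" for k and n :: nat
    using fold_upto_int[of Sw "m + k" n] fold_upto_int[of Tw k n] by (simp_all add: algebra_simps)
  have foldr_eq: "foldr (\<lambda>i. cadjoint (Sw i)) [m - int n + k..m - 1 + k] =
      fold (\<lambda>i. cadjoint (Sw (m + k - 1 - int i))) [0..<n]"
    "foldr (\<lambda>i. cadjoint (Tw i)) [- int n + k..- 1 + k] =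
      fold (\<lambda>i. cadjoint (Tw (k - 1 - int i))) [0..<n]" for k and n :: nat
    using foldr_upto_int[of "\<lambda>i. cadjoint (Sw i)" "m + k - 1" n]
      foldr_upto_int[of "\<lambda>i. cadjoint (Tw i)" "k - 1" n]
    by (simp_all add: algebra_simps)
  have fwd: "(\<forall>x. \<forall>n::nat. n \<ge> 1 \<longrightarrow> norm (fold Sw [m + k..m + int n + k - 1] x) =
        norm (fold Tw [k..int n + k - 1] (V x))) \<longleftrightarrow>
      (\<exists>P. P 0 = V \<and> (\<forall>n. unitary (P n) \<and> P (Suc n) \<circ> Sw (m + k + int n) = Tw (k + int n) \<circ> P n))"
    if "unitary V" for k V
    unfolding fold_eq
    using one_sided_intertwiners_iff[of "\<lambda>i. Sw (m + k + int i)" "\<lambda>i. Tw (k + int i)", OF bc(1) dense(1)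
        bc(2) dense(2) that] by blast
  have bwd: "(\<forall>x. \<forall>n::nat. n \<ge> 1 \<longrightarrow>
        norm (foldr (\<lambda>i. cadjoint (Sw i)) [m - int n + k..m - 1 + k] x) =
        norm (foldr (\<lambda>i. cadjoint (Tw i)) [- int n + k..- 1 + k] (V x))) \<longleftrightarrow>
      (\<exists>Q. Q 0 = V \<and> (\<forall>n. unitary (Q n) \<and> Q (Suc n) \<circ> cadjoint (Sw (m + k - 1 - int n)) =
        cadjoint (Tw (k - 1 - int n)) \<circ> Q n))"
    if "unitary V" for k V
    unfolding foldr_eq
    \<comment> \<open>Injectivity of the weights gives their adjoints dense range, just as dense
      range of the weights themselves serves the forward half.\<close>
    using one_sided_intertwiners_iff[of "\<lambda>i. cadjoint (Sw (m + k - 1 - int i))"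
        "\<lambda>i. cadjoint (Tw (k - 1 - int i))", OF bounded_clinear_cadjoint[OF bc(1)]
        dense_range_cadjoint[OF bc(1) inj(1)] bounded_clinear_cadjoint[OF bc(2)]
        dense_range_cadjoint[OF bc(2) inj(2)] that] by blast
  show ?thesis
    unfolding diagonal_intertwiner_iff[OF assms(1,2,4)] chain
    by (intro arg_cong[where f = Ex] ext conj_cong refl fwd[symmetric] bwd[symmetric])
qed

end
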